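(* Let $p>1$, $\gamma>0$ and $-1<\mu,\nu<p-1$. Let $\lambda$ be a positive Borel measure on $[0,1)$ such that $d\rho(t):=(1-t)^{\gamma-1}d\lambda(t)$ is a finite measure on $[0,1)$. For a sequence $a=\{a_n\}_{n=1}^{\infty}$ of complex numbers, define $$\widehat{\mathbf{H}}^{\mu,\nu}_{\gamma,\lambda}(a)(m):=\sum_{n=1}^{\infty}m^{\frac{\mu}{p}}n^{-\frac{\nu}{p}}\,\mathcal{I}_\lambda[m,n]\,a_n,\quad m\ge 1,\qquad \mathcal{I}_\lambda[m,n]=\int_{[0,1)}t^{\max\{m,n\}-1}(1-t)^{\gamma-1}d\lambda(t),\quad m,n\ge1.$$ Then $\widehat{\mathbf{H}}^{\mu,\nu}_{\gamma,\lambda}$ is bounded on $l^p$ if and only if $\rho$ is a $[1+\frac1p(\mu-\nu)]$-Carleson measure on $[0,1)$.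
   Context: $l^p$ is the space of complex sequences $a=\{a_n\}_{n=1}^{\infty}$ with $\|a\|_p=\left(\sum_{n=1}^{\infty}|a_n|^p\right)^{1/p}<+\infty$. An operator $T$ given by such a formula is bounded on $l^p$ if for every $a\in l^p$ the series defining $T(a)(m)$ converges for all $m\geq 1$, $T(a)=\{T(a)(m)\}_{m=1}^\infty\in l^p$, and there is a constant $C$ with $\|T(a)\|_p\le C\|a\|_p$ for all $a\in l^p$. For $s>0$, a positive Borel measure $\rho$ on $[0,1)$ is an $s$-Carleson measure if there is a constant $C>0$ such that $\rho([t,1))\le C(1-t)^s$ for all $t\in[0,1)$. The convention $t^0=1$ for all $t\in[0,1)$ is used. *)

theory Defs
  imports "HOL-Analysis.Analysis"
begin

text \<open>
  Sequences are indexed by the positive integers: a sequence is a function on \<^typ>\<open>nat\<close> whose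
  value at index 0 is ignored, so every series below is shifted by \<^const>\<open>Suc\<close>.
\<close>

definition lp_space :: "real \<Rightarrow> (nat \<Rightarrow> complex) set" where
  "lp_space p = {a. summable (\<lambda>n. norm (a (Suc n)) powr p)}"

definition lp_norm :: "real \<Rightarrow> (nat \<Rightarrow> complex) \<Rightarrow> real" where
  "lp_norm p a = (\<Sum>n. norm (a (Suc n)) powr p) powr (1 / p)"

definition matrix_op :: "(nat \<Rightarrow> nat \<Rightarrow> complex) \<Rightarrow> (nat \<Rightarrow> complex) \<Rightarrow> nat \<Rightarrow> complex" where
  "matrix_op K a m = (\<Sum>n. K m (Suc n) * a (Suc n))"

definition bounded_on_lp :: "real \<Rightarrow> (nat \<Rightarrow> nat \<Rightarrow> complex) \<Rightarrow> bool" where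
  "bounded_on_lp p K \<longleftrightarrow>
     (\<forall>a\<in>lp_space p. (\<forall>m\<ge>1. summable (\<lambda>n. K m (Suc n) * a (Suc n))) \<and>
                     matrix_op K a \<in> lp_space p) \<and>
     (\<exists>C. \<forall>a\<in>lp_space p. lp_norm p (matrix_op K a) \<le> C * lp_norm p a)"

definition carleson_measure :: "real \<Rightarrow> real measure \<Rightarrow> bool" where
  "carleson_measure s \<rho> \<longleftrightarrow>
     (\<exists>C>0. \<forall>t\<in>{0..<1}. emeasure \<rho> {t..<1} \<le> ennreal (C * (1 - t) powr s))"

definition weighted_measure :: "real \<Rightarrow> real measure \<Rightarrow> real measure" where
  "weighted_measure \<gamma> lam = density lam (\<lambda>t. ennreal ((1 - t) powr (\<gamma> - 1)))"

text \<open>The power of \<open>t\<close> has a natural number exponent, so \<open>t ^ 0 = 1\<close> also for \<open>t = 0\<close>.\<close>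

definition moment_integral :: "real \<Rightarrow> real measure \<Rightarrow> nat \<Rightarrow> nat \<Rightarrow> real" where
  "moment_integral \<gamma> lam m n = (\<integral>t. t ^ (max m n - 1) * (1 - t) powr (\<gamma> - 1) \<partial>lam)"

definition hilbert_kernel ::
    "real \<Rightarrow> real \<Rightarrow> real \<Rightarrow> real \<Rightarrow> real measure \<Rightarrow> nat \<Rightarrow> nat \<Rightarrow> complex" where
  "hilbert_kernel p \<mu> \<nu> \<gamma> lam m n =
     complex_of_real (real m powr (\<mu> / p) * real n powr (- (\<nu> / p)) * moment_integral \<gamma> lam m n)"

end

theory Submission imports Defs
begin

text \<open>
  Put \<open>s = 1 + (\<mu> - \<nu>) / p > 0\<close> and let \<open>M k\<close> be the \<open>k\<close>-th moment of \<open>\<rho>\<close>. The Carleson condition is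
  equivalent to \<open>M k = O(k powr (- s))\<close>. Given this decay, the kernel is dominated by a kernel
  homogeneous of degree \<open>-1\<close>, to which the Schur test with weights \<open>n powr (- 1 / p)\<close> applies.
  Conversely, on the block \<open>[N, 2N) \<times> [N, 2N)\<close> the kernel is at least a constant times
  \<open>N powr (s - 1) * M (2N)\<close>, so testing the operator on the indicator of \<open>[N, 2N)\<close> bounds \<open>M (2N)\<close>.
\<close>

section \<open>The Schur test\<close>

text \<open>The endpoint 0 is included because Jensen's inequality will be applied to sequences with
  zero entries. When \<open>x\<close> or \<open>y\<close> is 0, the claim reduces to
  \<open>c powr p \<le> c\<close> for \<open>0 < c < 1\<close>.\<close>

lemma convex_on_powr_atLeast:
  fixes p :: real
  assumes "p \<ge> 1"
  shows "convex_on {0..} (\<lambda>x. x powr p)"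
proof (rule convex_onI)
  fix t x y :: real
  assume t: "0 < t" "t < 1" and xy: "x \<in> {0..}" "y \<in> {0..}"
  have scale: "(c * z) powr p \<le> c * z powr p" if "0 < c" "c < 1" "0 \<le> z" for c z :: real
    using powr_mono'[of 1 p c] that assms by (simp add: powr_mult mult_right_mono)
  consider "x = 0" | "y = 0" | "x > 0" "y > 0"
    using xy by force
  then show "((1 - t) *\<^sub>R x + t *\<^sub>R y) powr p \<le> (1 - t) * x powr p + t * y powr p"
  proof cases
    case 3
    then show ?thesis
      using convex_onD[OF powr_convex[OF assms], of t x y] t by simp
  qed (use t xy scale[of t y] scale[of "1 - t" x] in auto)
qed simp

text \<open>Jensen's inequality for the normalised weights \<open>w i / W\<close>, where
  \<open>W\<close> is the total weight. Undoing the normalisation turns \<open>W powr p / W\<close>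
  into the factor \<open>W powr (p - 1)\<close>. If \<open>W\<close> is 0, both sides
  vanish.\<close>

lemma sum_powr_Jensen:
  fixes w x :: "'a \<Rightarrow> real"
  assumes "finite I" "p \<ge> 1" and w: "\<And>i. i \<in> I \<Longrightarrow> 0 \<le> w i" and x: "\<And>i. i \<in> I \<Longrightarrow> 0 \<le> x i"
  shows "(\<Sum>i\<in>I. w i * x i) powr p \<le> (\<Sum>i\<in>I. w i) powr (p - 1) * (\<Sum>i\<in>I. w i * x i powr p)"
proof (cases "(\<Sum>i\<in>I. w i) = 0")
  case True
  then have "\<forall>i\<in>I. w i = 0"
    using assms by (simp add: sum_nonneg_eq_0_iff)
  then show ?thesis
    by simp
next
  case False
  define W where "W = (\<Sum>i\<in>I. w i)"
  have W: "W > 0"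
    using False w by (simp add: W_def order_less_le sum_nonneg)
  have "(\<Sum>i\<in>I. (w i / W) *\<^sub>R x i) powr p \<le> (\<Sum>i\<in>I. (w i / W) * x i powr p)"
  proof (rule convex_on_sum[where C = "{0..}" and f = "\<lambda>x. x powr p"])
    show "(\<Sum>i\<in>I. w i / W) = 1"
      using W by (simp add: W_def flip: sum_divide_distrib)
    show "convex_on {0..} (\<lambda>x. x powr p)"
      by (rule convex_on_powr_atLeast) fact
  qed (use assms W False in auto)
  also have "(\<Sum>i\<in>I. (w i / W) *\<^sub>R x i) = (\<Sum>i\<in>I. w i * x i) / W"
    by (simp add: sum_divide_distrib)
  also have "(\<Sum>i\<in>I. (w i / W) * x i powr p) = (\<Sum>i\<in>I. w i * x i powr p) / W"
    by (simp add: sum_divide_distrib)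
  finally have "(\<Sum>i\<in>I. w i * x i) powr p / W powr p \<le> (\<Sum>i\<in>I. w i * x i powr p) / W"
    using W w x by (simp add: powr_divide sum_nonneg)
  then have "(\<Sum>i\<in>I. w i * x i) powr p \<le> (\<Sum>i\<in>I. w i * x i powr p) / W * W powr p"
    using W by (simp add: pos_divide_le_eq)
  also have "\<dots> = W powr (p - 1) * (\<Sum>i\<in>I. w i * x i powr p)"
    using W by (simp add: powr_diff)
  finally show ?thesis
    by (simp add: W_def)
qed

text \<open>Jensen's inequality is applied to the values \<open>x n / u n\<close> with weights
  \<open>k m n * u n\<close>; the row bound then enters with exponent \<open>p - 1\<close>.
  Interchanging the sums brings in the column bound, and the powers of \<open>u\<close>
  cancel.\<close>

lemma Schur_test_finite:
  fixes k :: "nat \<Rightarrow> nat \<Rightarrow> real"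
  assumes "p \<ge> 1" "0 \<le> A" and k: "\<And>m n. 0 \<le> k m n" and x: "\<And>n. 0 \<le> x n"
    and u: "\<And>n. 0 < u n" and v: "\<And>m. 0 \<le> v m"
    and row: "\<And>m N. (\<Sum>n<N. k m n * u n) \<le> A * v m"
    and col: "\<And>n M. (\<Sum>m<M. k m n * v m powr (p - 1)) \<le> B * u n powr (p - 1)"
  shows "(\<Sum>m<M. (\<Sum>n<N. k m n * x n) powr p) \<le> A powr (p - 1) * B * (\<Sum>n<N. x n powr p)"
proof -
  have "(\<Sum>n<N. k m n * x n) powr p
      \<le> A powr (p - 1) * (\<Sum>n<N. u n * (x n / u n) powr p * (k m n * v m powr (p - 1)))" for m
  proof -
    have "(\<Sum>n<N. k m n * x n) = (\<Sum>n<N. (k m n * u n) * (x n / u n))"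
      using u by (intro sum.cong) (simp_all add: less_imp_neq[THEN not_sym])
    also have "\<dots> powr p \<le> (\<Sum>n<N. k m n * u n) powr (p - 1) * (\<Sum>n<N. k m n * u n * (x n / u n) powr p)"
      using assms by (intro sum_powr_Jensen) (auto simp: less_imp_le)
    also have "\<dots> \<le> (A * v m) powr (p - 1) * (\<Sum>n<N. k m n * u n * (x n / u n) powr p)"
      using assms by (intro mult_right_mono powr_mono2 row sum_nonneg mult_nonneg_nonneg) (auto simp: less_imp_le)
    finally show ?thesis
      using \<open>0 \<le> A\<close> v by (simp add: powr_mult sum_distrib_left mult_ac)
  qed
  then have "(\<Sum>m<M. (\<Sum>n<N. k m n * x n) powr p)
      \<le> (\<Sum>m<M. A powr (p - 1) * (\<Sum>n<N. u n * (x n / u n) powr p * (k m n * v m powr (p - 1))))"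
    by (rule sum_mono)
  also have "\<dots> = A powr (p - 1) * (\<Sum>n<N. u n * (x n / u n) powr p * (\<Sum>m<M. k m n * v m powr (p - 1)))"
    unfolding sum_distrib_left by (subst sum.swap) (simp add: mult_ac)
  also have "\<dots> \<le> A powr (p - 1) * (\<Sum>n<N. u n * (x n / u n) powr p * (B * u n powr (p - 1)))"
    using u by (intro mult_left_mono sum_mono col) (simp_all add: less_imp_le)
  also have "(\<Sum>n<N. u n * (x n / u n) powr p * (B * u n powr (p - 1))) = (\<Sum>n<N. B * x n powr p)"
  proof (rule sum.cong)
    fix n
    show "u n * (x n / u n) powr p * (B * u n powr (p - 1)) = B * x n powr p"
      using u[of n] x[of n] by (simp add: powr_divide powr_diff)
  qed simp
  finally show ?thesis
    by (simp add: sum_distrib_left mult_ac)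
qed

text \<open>The finite bound is uniform in the numbers of rows and columns. For a single row it
  gives absolute convergence of the series; letting the number of columns and then the number of
  rows tend to infinity gives the norm bound.\<close>

lemma bounded_on_lp_Schur_test:
  fixes k :: "nat \<Rightarrow> nat \<Rightarrow> real"
  assumes p: "p \<ge> 1" and "0 \<le> A" "0 \<le> B" and k: "\<And>m n. 0 \<le> k m n"
    and u: "\<And>n. 0 < u n" and v: "\<And>m. 0 \<le> v m"
    and row: "\<And>m N. (\<Sum>n<N. k (Suc m) (Suc n) * u n) \<le> A * v m"
    and col: "\<And>n M. (\<Sum>m<M. k (Suc m) (Suc n) * v m powr (p - 1)) \<le> B * u n powr (p - 1)"
  shows "bounded_on_lp p (\<lambda>m n. complex_of_real (k m n))"
proof -
  define C where "C = A powr (p - 1) * B"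
  have "C \<ge> 0"
    using assms by (simp add: C_def)
  have main: "(\<forall>m\<ge>1. summable (\<lambda>n. complex_of_real (k m (Suc n)) * a (Suc n))) \<and>
      summable (\<lambda>m. norm (matrix_op (\<lambda>m n. complex_of_real (k m n)) a (Suc m)) powr p) \<and>
      (\<Sum>m. norm (matrix_op (\<lambda>m n. complex_of_real (k m n)) a (Suc m)) powr p)
        \<le> C * (\<Sum>n. norm (a (Suc n)) powr p)"
    if a: "summable (\<lambda>n. norm (a (Suc n)) powr p)" for a
  proof -
    define S where "S = (\<Sum>n. norm (a (Suc n)) powr p)"
    define f where "f m n = k (Suc m) (Suc n) * norm (a (Suc n))" for m n
    have f0: "0 \<le> f m n" for m n
      using k by (simp add: f_def)
    have fin: "(\<Sum>m<M. (\<Sum>n<N. f m n) powr p) \<le> C * S" for M N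
    proof -
      have "(\<Sum>m<M. (\<Sum>n<N. f m n) powr p) \<le> C * (\<Sum>n<N. norm (a (Suc n)) powr p)"
        unfolding f_def C_def using assms
        by (intro Schur_test_finite[where k = "\<lambda>m n. k (Suc m) (Suc n)" and u = u and v = v]) auto
      also have "\<dots> \<le> C * S"
        unfolding S_def using \<open>C \<ge> 0\<close> a by (intro mult_left_mono sum_le_suminf) auto
      finally show ?thesis .
    qed
    have sf: "summable (f m)" for m
    proof (rule summableI_nonneg_bounded)
      fix N
      \<comment> \<open>The row \<open>m\<close> is one term of the sum over the first
        \<open>Suc m\<close> rows, whose terms are nonnegative.\<close>
      have "(\<Sum>n<N. f m n) powr p \<le> (\<Sum>m<Suc m. (\<Sum>n<N. f m n) powr p)"
        by (simp add: sum_nonneg)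
      also have "\<dots> \<le> C * S"
        by (rule fin)
      finally have "((\<Sum>n<N. f m n) powr p) powr (1 / p) \<le> (C * S) powr (1 / p)"
        using p by (intro powr_mono2) auto
      then show "(\<Sum>n<N. f m n) \<le> (C * S) powr (1 / p)"
        using p f0 by (simp add: powr_powr sum_nonneg)
    qed (rule f0)
    have norm_f: "norm (complex_of_real (k (Suc m) (Suc n)) * a (Suc n)) = f m n" for m n
      using k by (simp add: f_def norm_mult)
    have s: "summable (\<lambda>n. complex_of_real (k (Suc m) (Suc n)) * a (Suc n))" for m
      by (rule summable_norm_cancel) (simp only: norm_f sf)
    have le: "norm (matrix_op (\<lambda>m n. complex_of_real (k m n)) a (Suc m)) powr p \<le> (\<Sum>n. f m n) powr p" for m
      using summable_norm[of "\<lambda>n. complex_of_real (k (Suc m) (Suc n)) * a (Suc n)"] sf p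
      unfolding matrix_op_def norm_f by (intro powr_mono2) auto
    \<comment> \<open>\<open>M\<close> stays fixed while \<open>N\<close> tends to infinity, so only
      a finite sum of limits is taken.\<close>
    have fin2: "(\<Sum>m<M. (\<Sum>n. f m n) powr p) \<le> C * S" for M
    proof (rule LIMSEQ_le_const2)
      show "(\<lambda>N. \<Sum>m<M. (\<Sum>n<N. f m n) powr p) \<longlonglongrightarrow> (\<Sum>m<M. (\<Sum>n. f m n) powr p)"
        using p sf f0 by (intro tendsto_sum tendsto_powr2 summable_LIMSEQ tendsto_const) (auto intro!: always_eventually sum_nonneg)
      show "\<exists>N. \<forall>n\<ge>N. (\<Sum>m<M. (\<Sum>n<n. f m n) powr p) \<le> C * S"
        using fin by blast
    qed
    have fin3: "(\<Sum>m<M. norm (matrix_op (\<lambda>m n. complex_of_real (k m n)) a (Suc m)) powr p) \<le> C * S" for M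
      using le fin2 by (meson order_trans sum_mono)
    have 1: "summable (\<lambda>m. norm (matrix_op (\<lambda>m n. complex_of_real (k m n)) a (Suc m)) powr p)"
      by (rule summableI_nonneg_bounded[OF _ fin3]) simp
    moreover have "(\<Sum>m. norm (matrix_op (\<lambda>m n. complex_of_real (k m n)) a (Suc m)) powr p) \<le> C * S"
      by (rule suminf_le_const[OF 1 fin3])
    moreover have "summable (\<lambda>n. complex_of_real (k m (Suc n)) * a (Suc n))" if "m \<ge> 1" for m
      using s[of "m - 1"] that by simp
    ultimately show ?thesis
      by (auto simp: S_def)
  qed
  have "lp_norm p (matrix_op (\<lambda>m n. complex_of_real (k m n)) a) \<le> C powr (1 / p) * lp_norm p a"
    if "a \<in> lp_space p" for a
  proof -
    have a: "summable (\<lambda>n. norm (a (Suc n)) powr p)"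
      using that by (simp add: lp_space_def)
    have "(\<Sum>m. norm (matrix_op (\<lambda>m n. complex_of_real (k m n)) a (Suc m)) powr p) powr (1 / p)
        \<le> (C * (\<Sum>n. norm (a (Suc n)) powr p)) powr (1 / p)"
      using main[OF a] p by (intro powr_mono2 suminf_nonneg) auto
    also have "\<dots> = C powr (1 / p) * (\<Sum>n. norm (a (Suc n)) powr p) powr (1 / p)"
      using \<open>C \<ge> 0\<close> a by (simp add: powr_mult suminf_nonneg)
    finally show ?thesis
      by (simp add: lp_norm_def)
  qed
  then have "\<exists>D. \<forall>a\<in>lp_space p. lp_norm p (matrix_op (\<lambda>m n. complex_of_real (k m n)) a) \<le> D * lp_norm p a"
    by (intro exI ballI)
  moreover have "\<forall>a\<in>lp_space p. (\<forall>m\<ge>1. summable (\<lambda>n. complex_of_real (k m (Suc n)) * a (Suc n))) \<and>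
      matrix_op (\<lambda>m n. complex_of_real (k m n)) a \<in> lp_space p"
    unfolding lp_space_def using main by (intro ballI) simp
  ultimately show ?thesis
    unfolding bounded_on_lp_def by (rule conjI[rotated])
qed

section \<open>Sums of powers\<close>

text \<open>The constant serves both signs of \<open>e\<close>: for \<open>e \<ge> 0\<close> it is
  at most 1 and the power is increasing; for \<open>e < 0\<close> the worst case is
  \<open>x = 2 * y\<close>, where equality holds.\<close>

lemma powr_ge_on_dyadic_block:
  fixes x y e :: real
  assumes "0 < y" "y \<le> x" "x \<le> 2 * y"
  shows "2 powr (- \<bar>e\<bar>) * y powr e \<le> x powr e"
proof (cases "e \<ge> 0")
  case True
  have "2 powr (- \<bar>e\<bar>) * y powr e \<le> 1 * y powr e"
    using powr_mono[of "- \<bar>e\<bar>" 0 2] by (intro mult_right_mono) simp_all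
  also have "\<dots> \<le> x powr e"
    using True assms by (simp add: powr_mono2)
  finally show ?thesis .
next
  case False
  then have "2 powr (- \<bar>e\<bar>) * y powr e = (2 * y) powr e"
    by (simp add: powr_mult)
  also have "\<dots> \<le> x powr e"
    using False assms by (intro powr_mono2') auto
  finally show ?thesis .
qed

text \<open>Mean value theorem for the power \<open>e + 1\<close>, used to compare the terms of a
  power sum with telescoping differences.\<close>

lemma powr_increment:
  fixes x e :: real
  assumes "0 < x"
  obtains z where "x < z" "z < x + 1" "(x + 1) powr (e + 1) - x powr (e + 1) = (e + 1) * z powr e"
proof -
  have "\<exists>z. x < z \<and> z < x + 1 \<and>
      (x + 1) powr (e + 1) - x powr (e + 1) = (x + 1 - x) * ((e + 1) * z powr e)"
  proof (rule MVT2)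
    fix z assume "x \<le> z"
    with assms show "((\<lambda>z. z powr (e + 1)) has_real_derivative (e + 1) * z powr e) (at z)"
      by (auto intro!: derivative_eq_intros)
  qed simp
  then show thesis
    using that by auto
qed

text \<open>For \<open>e \<ge> 0\<close> each term is at most \<open>m powr e\<close>. For
  \<open>-1 < e < 0\<close> the power \<open>e\<close> is decreasing, so \<open>e + 1\<close> times
  a term is at most the increment of the power \<open>e + 1\<close> over the preceding unit step,
  and these increments telescope.\<close>

lemma sum_powr_le:
  fixes e :: real
  assumes "-1 < e"
  shows "\<exists>C\<ge>0. \<forall>m. (\<Sum>n<m. real (Suc n) powr e) \<le> C * real m powr (e + 1)"
proof (cases "e \<ge> 0")
  case True
  have "(\<Sum>n<m. real (Suc n) powr e) \<le> real m powr (e + 1)" for m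
  proof -
    have "(\<Sum>n<m. real (Suc n) powr e) \<le> (\<Sum>n<m. real m powr e)"
      using True by (intro sum_mono powr_mono2) auto
    also have "\<dots> = real m powr (e + 1)"
      by (cases "m = 0") (simp_all add: powr_add)
    finally show ?thesis .
  qed
  then show ?thesis
    by (intro exI[of _ 1]) simp
next
  case False
  have step: "real (Suc m) powr e * (e + 1) \<le> real (Suc m) powr (e + 1) - real m powr (e + 1)" for m
  proof (cases "m = 0")
    \<comment> \<open>The mean value argument needs a positive base point. At 0 the claim reads
      \<open>e + 1 \<le> 1\<close>, since \<open>0 powr (e + 1) = 0\<close>.\<close>
    case True
    with False assms show ?thesis by simp
  next
    case m: False
    then obtain z where z: "real m < z" "z < real m + 1"
      "(real m + 1) powr (e + 1) - real m powr (e + 1) = (e + 1) * z powr e"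
      using powr_increment[of "real m" e] by auto
    have "(real m + 1) powr e \<le> z powr e"
      using z False by (intro powr_mono2') auto
    then show ?thesis
      using z assms by (simp add: mult.commute mult_left_mono add.commute)
  qed
  have "(\<Sum>n<m. real (Suc n) powr e) * (e + 1) \<le> real m powr (e + 1)" for m
  proof (induction m)
    case (Suc m)
    then show ?case
      using step[of m] by (simp add: algebra_simps)
  qed (use assms in simp)
  then show ?thesis
    using assms by (intro exI[of _ "1 / (e + 1)"]) (simp add: field_simps)
qed

text \<open>Now \<open>e + 1\<close> is negative, and \<open>- e - 1\<close> times a term is at most
  the drop of the power \<open>e + 1\<close> over the preceding unit step. The drops telescope from
  \<open>m\<close> to \<open>N\<close>; the remainder at \<open>N\<close> is subtracted and can be
  discarded.\<close>

lemma sum_powr_tail_le: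
  fixes e :: real
  assumes "e < -1"
  shows "\<exists>C\<ge>0. \<forall>m\<ge>1. \<forall>N. (\<Sum>n\<in>{m..<N}. real (Suc n) powr e) \<le> C * real m powr (e + 1)"
proof -
  have powr_step: "real (Suc m) powr e * (- e - 1) \<le> real m powr (e + 1) - real (Suc m) powr (e + 1)"
    if "m \<ge> 1" for m
  proof -
    have m_pos: "real m > 0"
      using that by simp
    obtain z where z: "real m < z" "z < real m + 1"
      "(real m + 1) powr (e + 1) - real m powr (e + 1) = (e + 1) * z powr e"
      by (rule powr_increment[OF m_pos])
    have "(real m + 1) powr e \<le> z powr e"
      using z assms by (intro powr_mono2') auto
    then have "(real m + 1) powr e * (- e - 1) \<le> z powr e * (- e - 1)"
      using assms by (intro mult_right_mono) auto
    also have "\<dots> = real m powr (e + 1) - (real m + 1) powr (e + 1)"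
      using z by (simp add: algebra_simps)
    finally show ?thesis
      by (simp add: add.commute)
  qed
  have *: "(\<Sum>n\<in>{m..<N}. real (Suc n) powr e) * (- e - 1) \<le> real m powr (e + 1) - real N powr (e + 1)"
    if "m \<ge> 1" "m \<le> N" for m N
    using that(2)
  proof (induction N rule: dec_induct)
    case (step N)
    then show ?case
      using assms \<open>m \<ge> 1\<close> powr_step[of N]
      by (simp add: algebra_simps)
  qed simp
  have "(\<Sum>n\<in>{m..<N}. real (Suc n) powr e) \<le> 1 / (- e - 1) * real m powr (e + 1)" if "m \<ge> 1" for m N
  proof (cases "m \<le> N")
    case True
    have "(\<Sum>n\<in>{m..<N}. real (Suc n) powr e) * (- e - 1) \<le> real m powr (e + 1)"
      using *[OF that True] powr_ge_zero[of "real N" "e + 1"] by linarith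
    then show ?thesis
      using assms by (simp add: pos_le_divide_eq)
  qed (use assms in simp)
  then show ?thesis
    using assms by (intro exI[of _ "1 / (- e - 1)"]) auto
qed

text \<open>The sum splits where the maximum changes: it is \<open>Suc m\<close> for
  \<open>n \<le> m\<close> and \<open>Suc n\<close> afterwards. The condition on \<alpha> controls
  the head, that on \<open>\<alpha> - \<sigma>\<close> the tail, and both parts have the same order
  in \<open>Suc m\<close>.\<close>

lemma sum_powr_max_le:
  fixes \<alpha> \<sigma> :: real
  assumes "-1 < \<alpha>" "\<alpha> - \<sigma> < -1"
  shows "\<exists>C\<ge>0. \<forall>m N. (\<Sum>n<N. real (Suc n) powr \<alpha> * real (max (Suc m) (Suc n)) powr (- \<sigma>))
      \<le> C * real (Suc m) powr (\<alpha> + 1 - \<sigma>)"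
proof -
  obtain C where C: "C \<ge> 0" "\<And>m. (\<Sum>n<m. real (Suc n) powr \<alpha>) \<le> C * real m powr (\<alpha> + 1)"
    using sum_powr_le[OF assms(1)] by blast
  obtain D where D: "D \<ge> 0"
    "\<And>m N. m \<ge> 1 \<Longrightarrow> (\<Sum>n\<in>{m..<N}. real (Suc n) powr (\<alpha> - \<sigma>)) \<le> D * real m powr (\<alpha> - \<sigma> + 1)"
    using sum_powr_tail_le[OF assms(2)] by blast
  have "(\<Sum>n<N. real (Suc n) powr \<alpha> * real (max (Suc m) (Suc n)) powr (- \<sigma>))
      \<le> (C + D) * real (Suc m) powr (\<alpha> + 1 - \<sigma>)" for m N
  proof -
    define f where "f n = real (Suc n) powr \<alpha> * real (max (Suc m) (Suc n)) powr (- \<sigma>)" for n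
    \<comment> \<open>Enlarging the range makes the head complete even when
      \<open>N \<le> m\<close>.\<close>
    have "sum f {..<N} \<le> sum f {..<max N (Suc m)}"
      by (intro sum_mono2) (auto simp: f_def)
    also have "{..<max N (Suc m)} = {..<Suc m} \<union> {Suc m..<max N (Suc m)}"
      by auto
    also have "sum f \<dots> = sum f {..<Suc m} + sum f {Suc m..<max N (Suc m)}"
      by (rule sum.union_disjoint) auto
    also have "sum f {..<Suc m} = (\<Sum>n<Suc m. real (Suc n) powr \<alpha>) * real (Suc m) powr (- \<sigma>)"
      unfolding sum_distrib_right by (rule sum.cong) (auto simp: f_def max_absorb1)
    also have "\<dots> \<le> C * real (Suc m) powr (\<alpha> + 1) * real (Suc m) powr (- \<sigma>)"
      by (rule mult_right_mono[OF C(2)]) simp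
    also have "\<dots> = C * real (Suc m) powr (\<alpha> + 1 - \<sigma>)"
      by (simp add: powr_diff powr_minus divide_inverse)
    also have "sum f {Suc m..<max N (Suc m)} = (\<Sum>n\<in>{Suc m..<max N (Suc m)}. real (Suc n) powr (\<alpha> - \<sigma>))"
      by (rule sum.cong) (auto simp: f_def max_def powr_diff powr_minus divide_inverse)
    also have "\<dots> \<le> D * real (Suc m) powr (\<alpha> + 1 - \<sigma>)"
      using D(2)[of "Suc m"] by (simp add: algebra_simps)
    finally show ?thesis
      by (simp add: f_def distrib_right)
  qed
  with C(1) D(1) show ?thesis
    by (intro exI[of _ "C + D"]) auto
qed

section \<open>Moments of measures on the unit interval\<close>

context
  fixes \<rho> :: "real measure"
  assumes sets_\<rho>: "sets \<rho> = sets (restrict_space borel {0..<1})"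
begin

lemma space_unit_interval: "space \<rho> = {0..<1}"
  using sets_eq_imp_space_eq[OF sets_\<rho>] by (simp add: space_restrict_space)

lemma borel_measurable_unit_interval:
  assumes "f \<in> borel_measurable borel"
  shows "f \<in> borel_measurable \<rho>"
  using measurable_restrict_space1[OF assms, of "{0..<1}"] measurable_cong_sets[OF sets_\<rho> refl]
  by blast

lemma sets_unit_interval: "0 \<le> t \<Longrightarrow> {t..<1} \<in> sets \<rho>"
  unfolding sets_\<rho> by (subst sets_restrict_space_iff) auto

context
  assumes finite_\<rho>: "finite_measure \<rho>"
begin

interpretation finite_measure \<rho>
  by (rule finite_\<rho>)

lemma integrable_moment: "integrable \<rho> (\<lambda>t. t ^ k)"
proof (rule integrable_const_bound[where B = 1])
  show "AE t in \<rho>. norm (t ^ k) \<le> 1"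
    by (rule AE_I2) (auto simp: space_unit_interval power_le_one)
  show "(\<lambda>t. t ^ k) \<in> borel_measurable \<rho>"
    by (rule borel_measurable_unit_interval) simp
qed

lemma moment_nonneg: "0 \<le> (\<integral>t. t ^ k \<partial>\<rho>)"
  by (rule integral_nonneg_AE, rule AE_I2) (auto simp: space_unit_interval)

lemma moment_antimono: "j \<le> k \<Longrightarrow> (\<integral>t. t ^ k \<partial>\<rho>) \<le> (\<integral>t. t ^ j \<partial>\<rho>)"
  by (rule integral_mono) (auto simp: integrable_moment space_unit_interval power_decreasing)

lemma carleson_measure_iff_measure:
  "carleson_measure s \<rho> \<longleftrightarrow> (\<exists>C>0. \<forall>t\<in>{0..<1}. measure \<rho> {t..<1} \<le> C * (1 - t) powr s)"
  unfolding carleson_measure_def emeasure_eq_measure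
  by (intro ex_cong1 conj_cong ball_cong refl) (auto simp: ennreal_le_iff)

text \<open>
  If \<open>j / k \<le> 1 - t < (j + 1) / k\<close> then \<open>t ^ k \<le> exp (- j)\<close>, so \<open>t ^ k\<close> is dominated by a step function
  whose \<open>j\<close>-th step lives on an interval of length \<open>(j + 1) / k\<close> ending at 1.
\<close>

lemma moment_le_of_carleson:
  assumes "carleson_measure s \<rho>" "0 < s"
  shows "\<exists>D\<ge>0. \<forall>k. (\<integral>t. t ^ k \<partial>\<rho>) \<le> D * real (Suc k) powr (- s)"
proof -
  obtain C where C: "C > 0" "\<And>t. t \<in> {0..<1} \<Longrightarrow> measure \<rho> {t..<1} \<le> C * (1 - t) powr s"
    using assms(1) unfolding carleson_measure_iff_measure by blast
  \<comment> \<open>Here \<open>(2 * s) powr s\<close> and \<open>exp (1 / 2)\<close> come from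
    bounding \<open>Suc j powr s\<close> by an exponential, and the denominator from the remaining
    geometric series of ratio \<open>exp (- (1 / 2))\<close>.\<close>
  define B where "B = C * (2 * s) powr s * exp (1 / 2) / (1 - exp (- (1 / 2)))"
  have "B \<ge> 0"
    using C(1) by (simp add: B_def)
  have moment: "(\<integral>t. t ^ k \<partial>\<rho>) \<le> B * real k powr (- s)" if k: "k \<ge> 1" for k
  proof -
    \<comment> \<open>For \<open>j < k\<close> the left end is nonnegative, so the interval lies in
      [0,1).\<close>
    define I where "I j = {1 - real (Suc j) / real k..<1}" for j
    have I: "I j \<in> sets \<rho>" if "j < k" for j
      unfolding I_def using that by (intro sets_unit_interval) simp
    have "(\<integral>t. t ^ k \<partial>\<rho>) \<le> (\<integral>t. (\<Sum>j<k. exp (- real j) * indicator (I j) t) \<partial>\<rho>)"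
    proof (rule integral_mono)
      show "integrable \<rho> (\<lambda>t. \<Sum>j<k. exp (- real j) * indicator (I j) t)"
        using I by (intro Bochner_Integration.integrable_sum integrable_mult_right integrable_real_indicator)
          (auto simp: emeasure_eq_measure)
      fix t assume "t \<in> space \<rho>"
      then have t: "0 \<le> t" "t < 1"
        by (auto simp: space_unit_interval)
      show "t ^ k \<le> (\<Sum>j<k. exp (- real j) * indicator (I j) t)"
      proof (cases "t = 0")
        \<comment> \<open>At \<open>t = 0\<close> the choice of \<open>j\<close> below would give
          \<open>k\<close>, outside the range of summation; but there \<open>t ^ k = 0\<close>, as
          \<open>k \<ge> 1\<close>.\<close>
        case True
        then show ?thesis
          using k by (auto simp: power_0_left intro!: sum_nonneg)
      next
        case False
        define j where "j = nat \<lfloor>real k * (1 - t)\<rfloor>"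
        have "real k * (1 - t) < real k"
          using k False t by (simp add: algebra_simps)
        moreover have j: "real j \<le> real k * (1 - t)" "real k * (1 - t) < real j + 1"
          using t by (simp_all add: j_def)
        ultimately have "j < k"
          by linarith
        have "t \<in> I j"
          using j k t by (simp add: I_def field_simps)
        have "t ^ k \<le> exp (- (1 - t)) ^ k"
          using t exp_ge_add_one_self[of "- (1 - t)"] by (intro power_mono) auto
        also have "\<dots> = exp (- (real k * (1 - t)))"
          by (simp only: mult_minus_right flip: exp_of_nat_mult)
        also have "\<dots> \<le> exp (- real j)"
          using j by simp
        also have "\<dots> = (\<Sum>i\<in>{j}. exp (- real i) * indicator (I i) t)"
          using \<open>t \<in> I j\<close> by simp
        also have "\<dots> \<le> (\<Sum>i<k. exp (- real i) * indicator (I i) t)"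
          using \<open>j < k\<close> by (intro sum_mono2) auto
        finally show ?thesis .
      qed
    qed (rule integrable_moment)
    also have "\<dots> = (\<Sum>j<k. exp (- real j) * measure \<rho> (I j))"
      using I by (subst Bochner_Integration.integral_sum) (auto simp: emeasure_eq_measure)
    also have "\<dots> \<le> (\<Sum>j<k. C * (2 * s) powr s * exp (1 / 2) * real k powr (- s) * exp (- (1 / 2)) ^ j)"
    proof (rule sum_mono)
      fix j assume "j \<in> {..<k}"
      then have "measure \<rho> (I j) \<le> C * (real (Suc j) / real k) powr s"
        using C(2)[of "1 - real (Suc j) / real k"] by (simp add: I_def)
      also have "\<dots> = C * real (Suc j) powr s * real k powr (- s)"
        by (simp add: powr_divide powr_minus_divide)
      \<comment> \<open>The inequality \<open>x \<le> exp x\<close> at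
        \<open>x = Suc j / (2 * s)\<close>, raised to the power \<open>s\<close>, costs only
        \<open>exp (Suc j / 2)\<close>, about half of the decay \<open>exp (- j)\<close>.\<close>
      also have "real (Suc j) powr s = (2 * s) powr s * (real (Suc j) / (2 * s)) powr s"
        using \<open>0 < s\<close> by (simp flip: powr_mult)
      also have "(real (Suc j) / (2 * s)) powr s \<le> exp (real (Suc j) / (2 * s)) powr s"
        using \<open>0 < s\<close> by (intro powr_mono2 order_trans[OF _ exp_ge_add_one_self]) auto
      also have "\<dots> = exp (real (Suc j) / 2)"
        using \<open>0 < s\<close> by (simp add: powr_def)
      finally have "exp (- real j) * measure \<rho> (I j)
          \<le> exp (- real j) * (C * ((2 * s) powr s * exp (real (Suc j) / 2)) * real k powr (- s))"
        using C(1) by (simp add: mult_left_mono mult_right_mono)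
      also have "\<dots> = C * (2 * s) powr s * real k powr (- s) * exp (- real j + real (Suc j) / 2)"
        by (simp only: exp_add mult_ac)
      also have "- real j + real (Suc j) / 2 = 1 / 2 + real j * (- (1 / 2))"
        by (simp add: field_simps)
      also have "exp \<dots> = exp (1 / 2) * exp (- (1 / 2)) ^ j"
        by (simp only: exp_add exp_of_nat_mult)
      finally show "exp (- real j) * measure \<rho> (I j)
          \<le> C * (2 * s) powr s * exp (1 / 2) * real k powr (- s) * exp (- (1 / 2)) ^ j"
        by (simp only: mult_ac)
    qed
    also have "\<dots> \<le> C * (2 * s) powr s * exp (1 / 2) * real k powr (- s) * (1 / (1 - exp (- (1 / 2))))"
    proof -
      have "(\<Sum>j<k. exp (- (1 / 2 :: real)) ^ j) \<le> (\<Sum>j. exp (- (1 / 2)) ^ j)"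
        by (intro sum_le_suminf summable_geometric) auto
      also have "\<dots> = 1 / (1 - exp (- (1 / 2)))"
        by (rule suminf_geometric) simp
      finally show ?thesis
        using C(1) unfolding sum_distrib_left[symmetric] by (intro mult_left_mono) auto
    qed
    finally show ?thesis
      by (simp add: B_def mult_ac)
  qed
  \<comment> \<open>The factor \<open>2 powr s\<close> pays for replacing \<open>k\<close> by
    \<open>Suc k \<le> 2 * k\<close>; the total mass covers \<open>k = 0\<close>.\<close>
  define D where "D = B * 2 powr s + measure \<rho> (space \<rho>)"
  have "(\<integral>t. t ^ k \<partial>\<rho>) \<le> D * real (Suc k) powr (- s)" for k
  proof (cases "k = 0")
    case True
    then show ?thesis
      using \<open>B \<ge> 0\<close> by (simp add: D_def)
  next
    case False
    have "real k powr (- s) \<le> (real (Suc k) / 2) powr (- s)"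
      using False \<open>0 < s\<close> by (intro powr_mono2') auto
    also have "\<dots> = 2 powr s * real (Suc k) powr (- s)"
      by (simp add: powr_divide powr_minus_divide)
    finally have "B * real k powr (- s) \<le> B * 2 powr s * real (Suc k) powr (- s)"
      using \<open>B \<ge> 0\<close> by (simp add: mult_left_mono mult.assoc)
    then show ?thesis
      using moment[of k] False
      by (simp add: D_def distrib_right add_increasing2)
  qed
  moreover have "D \<ge> 0"
    using \<open>B \<ge> 0\<close> by (simp add: D_def)
  ultimately show ?thesis
    by blast
qed

text \<open>Markov's inequality: on \<open>{t..<1}\<close> the integrand \<open>u ^ (2 * N)\<close>
  is at least \<open>t ^ (2 * N)\<close>, which stays above \<open>exp (- 4)\<close> if
  \<open>N\<close> is the integer part of \<open>1 / (1 - t)\<close> and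
  \<open>t \<ge> 1 / 2\<close>. For smaller \<open>t\<close> the total mass suffices.\<close>

lemma carleson_of_moment_le:
  assumes "0 < s" and D: "\<And>N. N \<ge> 1 \<Longrightarrow> (\<integral>t. t ^ (2 * N) \<partial>\<rho>) \<le> D * real N powr (- s)"
  shows "carleson_measure s \<rho>"
proof -
  define T where "T = measure \<rho> (space \<rho>)"
  have "0 \<le> D"
    using order_trans[OF moment_nonneg D[of 1]] by simp
  have "T \<ge> 0"
    by (simp add: T_def)
  \<comment> \<open>The first summand serves \<open>t \<ge> 1 / 2\<close>, the second
    \<open>t < 1 / 2\<close>, and the 1 ensures positivity.\<close>
  define C where "C = exp 4 * D * 2 powr s + T * 2 powr s + 1"
  have "C > 0"
    using \<open>0 \<le> D\<close> \<open>0 \<le> T\<close> by (simp add: C_def add_nonneg_pos)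
  moreover have "measure \<rho> {t..<1} \<le> C * (1 - t) powr s" if t: "t \<in> {0..<1}" for t
  proof (cases "t < 1 / 2")
    case True
    have "measure \<rho> {t..<1} \<le> T * 1"
      by (simp add: T_def bounded_measure)
    also have "1 \<le> (2 * (1 - t)) powr s"
      using True \<open>0 < s\<close> by (intro ge_one_powr_ge_zero) auto
    then have "T * 1 \<le> T * (2 * (1 - t)) powr s"
      using \<open>0 \<le> T\<close> by (rule mult_left_mono)
    also have "\<dots> = (T * 2 powr s) * (1 - t) powr s"
      using t by (subst powr_mult) auto
    also have "\<dots> \<le> C * (1 - t) powr s"
      using \<open>0 \<le> D\<close> by (intro mult_right_mono) (auto simp: C_def)
    finally show ?thesis .
  next
    case False
    define y where "y = 1 / (1 - t)"
    define N where "N = nat \<lfloor>y\<rfloor>"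
    have y: "y \<ge> 2"
      using False t by (simp add: y_def field_simps)
    have N: "real N \<le> y" "y < real N + 1"
      using y by (simp_all add: N_def)
    have N1: "N \<ge> 1" and N2: "y / 2 \<le> real N"
      using N y by linarith+
    \<comment> \<open>Since \<open>t \<ge> 1 / 2\<close>,
      \<open>1 / t \<le> 1 + 2 * (1 - t) \<le> exp (2 * (1 - t))\<close>. Inverting and raising to
      the power \<open>2 * N\<close>, with \<open>N * (1 - t) \<le> 1\<close>, produces the exponent
      4.\<close>
    have "exp (- 4) \<le> t ^ (2 * N)"
    proof -
      have "1 / t = 1 + (1 - t) / t"
        using False by (simp add: field_simps)
      also have "\<dots> \<le> 1 + 2 * (1 - t)"
      proof -
        have "(1 - t) * 1 \<le> (1 - t) * (2 * t)"
          using False t by (intro mult_left_mono) auto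
        then show ?thesis
          using False by (simp add: field_simps)
      qed
      also have "\<dots> \<le> exp (2 * (1 - t))"
        by (rule exp_ge_add_one_self)
      finally have "inverse (exp (2 * (1 - t))) \<le> inverse (1 / t)"
        by (rule le_imp_inverse_le) (use False in simp)
      then have "exp (- (2 * (1 - t))) \<le> t"
        by (simp only: exp_minus inverse_divide div_by_1)
      then have "exp (- (2 * (1 - t))) ^ (2 * N) \<le> t ^ (2 * N)"
        by (rule power_mono) simp
      moreover have "exp (- (2 * (1 - t))) ^ (2 * N) = exp (- (4 * (real N * (1 - t))))"
        by (simp add: algebra_simps flip: exp_of_nat_mult)
      moreover have "real N * (1 - t) \<le> 1"
        using N(1) t by (simp add: y_def field_simps)
      ultimately show ?thesis
        by (smt (verit) exp_le_cancel_iff)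
    qed
    have "exp (- 4) * measure \<rho> {t..<1} = (\<integral>u. exp (- 4) * indicator {t..<1} u \<partial>\<rho>)"
      using t by (simp add: sets_unit_interval space_unit_interval Int_absorb2)
    also have "\<dots> \<le> (\<integral>u. u ^ (2 * N) \<partial>\<rho>)"
    proof (rule integral_mono)
      show "integrable \<rho> (\<lambda>u. exp (- 4) * indicator {t..<1} u :: real)"
        using t sets_unit_interval[of t] by (simp add: emeasure_eq_measure)
      fix u assume "u \<in> space \<rho>"
      moreover have "exp (- 4) \<le> u ^ (2 * N)" if "t \<le> u"
        using \<open>exp (- 4) \<le> t ^ (2 * N)\<close> power_mono[OF that, of "2 * N"] t by simp
      ultimately show "exp (- 4) * indicator {t..<1} u \<le> u ^ (2 * N)"
        by (auto simp: indicator_def space_unit_interval)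
    qed (rule integrable_moment)
    also have "\<dots> \<le> D * real N powr (- s)"
      by (rule D[OF N1])
    also have "\<dots> \<le> D * (y / 2) powr (- s)"
      using \<open>0 \<le> D\<close> N2 y \<open>0 < s\<close> by (intro mult_left_mono powr_mono2') auto
    also have "(y / 2) powr (- s) = 2 powr s * y powr (- s)"
      using y by (simp add: powr_divide powr_minus_divide)
    also have "y powr (- s) = (1 - t) powr s"
      using t by (simp add: y_def powr_divide powr_minus_divide)
    finally have "measure \<rho> {t..<1} \<le> (exp 4 * D * 2 powr s) * (1 - t) powr s"
      by (simp add: exp_minus field_simps)
    also have "\<dots> \<le> C * (1 - t) powr s"
      using \<open>0 \<le> T\<close> by (intro mult_right_mono) (auto simp: C_def)
    finally show ?thesis .
  qed
  ultimately show ?thesis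
    unfolding carleson_measure_iff_measure by blast
qed

end

end

section \<open>Boundedness of the Hilbert type operator\<close>

text \<open>The indicator of the block has norm \<open>N powr (1 / p)\<close>, and its image has
  modulus at least \<open>N * L\<close> at the \<open>N\<close> indices of the block. The common
  factor \<open>N powr (1 / p)\<close> cancels, leaving a bound uniform in \<open>N\<close> and
  \<open>L\<close>.\<close>

lemma bounded_on_lp_block_bound:
  fixes k :: "nat \<Rightarrow> nat \<Rightarrow> real"
  assumes "p \<ge> 1" and bdd: "bounded_on_lp p (\<lambda>m n. complex_of_real (k m n))"
  obtains C where "\<And>N L. \<lbrakk>N \<ge> 1; 0 \<le> L; \<And>m n. \<lbrakk>m \<in> {N..<2 * N}; n \<in> {N..<2 * N}\<rbrakk> \<Longrightarrow> L \<le> k m n\<rbrakk> \<Longrightarrow> real N * L \<le> C"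
proof -
  define T where "T = matrix_op (\<lambda>m n. complex_of_real (k m n))"
  obtain C where C: "\<And>a. a \<in> lp_space p \<Longrightarrow> lp_norm p (T a) \<le> C * lp_norm p a"
    using bdd unfolding bounded_on_lp_def T_def by auto
  have T: "T a \<in> lp_space p" if "a \<in> lp_space p" for a
    using bdd that unfolding bounded_on_lp_def T_def by auto
  have "real N * L \<le> C"
    if N: "N \<ge> 1" and L: "0 \<le> L" and k: "\<And>m n. \<lbrakk>m \<in> {N..<2 * N}; n \<in> {N..<2 * N}\<rbrakk> \<Longrightarrow> L \<le> k m n" for N L
  proof -
    \<comment> \<open>The block shifted down by one, because the series run over
      \<open>Suc n\<close>.\<close>
    define J where "J = {N - 1..<2 * N - 1}"
    have J: "Suc n \<in> {N..<2 * N} \<longleftrightarrow> n \<in> J" for n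
      using N by (auto simp: J_def)
    have card_J: "card J = N" and fin_J: "finite J"
      using N by (simp_all add: J_def)
    define a :: "nat \<Rightarrow> complex" where "a = indicator {N..<2 * N}"
    have a: "a (Suc n) = (if n \<in> J then 1 else 0)" for n
      unfolding a_def indicator_def of_bool_def J ..
    have "(\<lambda>n. norm (a (Suc n)) powr p) sums (\<Sum>n\<in>J. norm (a (Suc n)) powr p)"
      by (rule sums_finite[OF fin_J]) (simp add: a)
    also have "(\<Sum>n\<in>J. norm (a (Suc n)) powr p) = real N"
      by (simp add: a card_J)
    finally have a_lp: "a \<in> lp_space p" and norm_a: "lp_norm p a = real N powr (1 / p)"
      unfolding lp_space_def lp_norm_def by (auto simp: sums_iff)
    have Ta: "T a m = complex_of_real (\<Sum>n\<in>J. k m (Suc n))" for m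
      unfolding T_def matrix_op_def using fin_J
      by (subst suminf_finite[of J]) (auto simp: a)
    have "real N * (real N * L) powr p = (\<Sum>m\<in>J. (real N * L) powr p)"
      by (simp add: card_J)
    also have "\<dots> \<le> (\<Sum>m\<in>J. norm (T a (Suc m)) powr p)"
    proof (rule sum_mono)
      fix m assume m: "m \<in> J"
      have "real N * L = (\<Sum>n\<in>J. L)"
        by (simp add: card_J)
      also have "\<dots> \<le> (\<Sum>n\<in>J. k (Suc m) (Suc n))"
        using m by (intro sum_mono k) (simp_all only: J)
      also have "\<dots> \<le> norm (T a (Suc m))"
        by (simp only: Ta norm_of_real abs_ge_self)
      finally show "(real N * L) powr p \<le> norm (T a (Suc m)) powr p"
        using assms(1) L by (intro powr_mono2) auto
    qed
    also have "\<dots> \<le> (\<Sum>m. norm (T a (Suc m)) powr p)"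
      using T[OF a_lp] fin_J unfolding lp_space_def by (intro sum_le_suminf) auto
    finally have "(real N * (real N * L) powr p) powr (1 / p) \<le> lp_norm p (T a)"
      unfolding lp_norm_def using assms(1) by (intro powr_mono2) auto
    also have "\<dots> \<le> C * real N powr (1 / p)"
      using C[OF a_lp] by (simp add: norm_a)
    also have "(real N * (real N * L) powr p) powr (1 / p) = (real N * L) * real N powr (1 / p)"
      using assms(1) L by (simp add: powr_mult powr_powr)
    finally show ?thesis
      using N by simp
  qed
  then show thesis
    using that by blast
qed

theorem theorem1p4:
  fixes p \<gamma> \<mu> \<nu> :: real and lam :: "real measure"
  assumes "p > 1" and "\<gamma> > 0"
    and "-1 < \<mu>" and "\<mu> < p - 1" and "-1 < \<nu>" and "\<nu> < p - 1"
    and "sets lam = sets (restrict_space borel {0..<1})"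
    and "finite_measure (weighted_measure \<gamma> lam)"
  shows "bounded_on_lp p (hilbert_kernel p \<mu> \<nu> \<gamma> lam) \<longleftrightarrow>
         carleson_measure (1 + (1 / p) * (\<mu> - \<nu>)) (weighted_measure \<gamma> lam)"
proof -
  define \<rho> where "\<rho> = weighted_measure \<gamma> lam"
  define s where "s = 1 + (1 / p) * (\<mu> - \<nu>)"
  define M where "M k = (\<integral>t. t ^ k \<partial>\<rho>)" for k :: nat
  define K where "K m n = real m powr (\<mu> / p) * real n powr (- (\<nu> / p)) * M (max m n - 1)" for m n
  have \<rho>: "sets \<rho> = sets (restrict_space borel {0..<1})" "finite_measure \<rho>"
    using assms by (simp_all add: \<rho>_def weighted_measure_def)
  note M_nonneg = moment_nonneg[OF \<rho>, folded M_def]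
  note M_antimono = moment_antimono[OF \<rho>, folded M_def]
  \<comment> \<open>From \<open>\<mu> > -1\<close> and \<open>\<nu> < p - 1\<close> one gets
    \<open>\<mu> - \<nu> > - p\<close>.\<close>
  have "s > 0"
    using assms by (simp add: s_def field_simps)
  have "moment_integral \<gamma> lam m n = M (max m n - 1)" for m n
  proof -
    have "(\<lambda>t. (1 - t) powr (\<gamma> - 1)) \<in> borel_measurable lam" "(\<lambda>t. t ^ (max m n - 1)) \<in> borel_measurable lam"
      by (rule borel_measurable_unit_interval[OF assms(7)], measurable)+
    then show ?thesis
      unfolding moment_integral_def M_def \<rho>_def weighted_measure_def
      by (subst integral_density) (auto simp: mult.commute)
  qed
  then have kernel: "hilbert_kernel p \<mu> \<nu> \<gamma> lam = (\<lambda>m n. complex_of_real (K m n))"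
    by (simp add: fun_eq_iff hilbert_kernel_def K_def)

  \<comment> \<open>Sufficiency of the Carleson condition\<close>
  have "bounded_on_lp p (\<lambda>m n. complex_of_real (K m n))" if carleson: "carleson_measure s \<rho>"
  proof -
    obtain D where D: "D \<ge> 0" "\<And>k. M k \<le> D * real (Suc k) powr (- s)"
      using moment_le_of_carleson[OF \<rho> carleson \<open>s > 0\<close>] unfolding M_def by blast
    have K_le: "K (Suc m) (Suc n) \<le> D * (real (Suc m) powr (\<mu> / p) * real (Suc n) powr (- (\<nu> / p))
        * real (max (Suc m) (Suc n)) powr (- s))" for m n
    proof -
      have "M (max (Suc m) (Suc n) - 1) \<le> D * real (max (Suc m) (Suc n)) powr (- s)"
        using D(2)[of "max m n"] by (simp only: max_Suc_Suc diff_Suc_1)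
      then show ?thesis
        unfolding K_def by (simp add: mult_left_mono mult.left_commute[of D])
    qed
    \<comment> \<open>\<alpha> is the exponent of the column index in the row sums weighted by
      \<open>u\<close>, and \<beta> that of the row index in the column sums weighted by
      \<open>u powr (p - 1)\<close>. The bounds \<open>\<nu> < p - 1\<close> and
      \<open>\<mu> > -1\<close> place both in the range of \<open>sum_powr_max_le\<close>.\<close>
    define \<alpha> where "\<alpha> = - (\<nu> / p) - 1 / p"
    define \<beta> where "\<beta> = \<mu> / p - (p - 1) / p"
    have "\<alpha> = - ((\<nu> + 1) / p)" "\<alpha> - s = - 1 - (\<mu> + 1) / p" "\<beta> = (\<mu> + 1) / p - 1" "\<beta> - s = (\<nu> + 1) / p - 2"
      using assms(1) by (simp_all add: \<alpha>_def \<beta>_def s_def field_simps)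
    moreover have "(\<nu> + 1) / p < 1" "0 < (\<mu> + 1) / p"
      using assms by simp_all
    ultimately have exps: "-1 < \<alpha>" "\<alpha> - s < -1" "-1 < \<beta>" "\<beta> - s < -1"
      by linarith+
    obtain A where A: "A \<ge> 0" "\<And>m N. (\<Sum>n<N. real (Suc n) powr \<alpha> * real (max (Suc m) (Suc n)) powr (- s))
        \<le> A * real (Suc m) powr (\<alpha> + 1 - s)"
      using sum_powr_max_le[OF exps(1,2)] by blast
    obtain B where B: "B \<ge> 0" "\<And>n M. (\<Sum>m<M. real (Suc m) powr \<beta> * real (max (Suc n) (Suc m)) powr (- s))
        \<le> B * real (Suc n) powr (\<beta> + 1 - s)"
      using sum_powr_max_le[OF exps(3,4)] by blast
    define u where "u n = real (Suc n) powr (- (1 / p))" for n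
    have u_powr: "u n powr (p - 1) = real (Suc n) powr (- ((p - 1) / p))" for n
      using assms(1) by (simp add: u_def powr_powr)
    show ?thesis
    proof (rule bounded_on_lp_Schur_test[where u = u and v = u and A = "D * A" and B = "D * B"])
      fix m N
      have "(\<Sum>n<N. K (Suc m) (Suc n) * u n)
          \<le> (\<Sum>n<N. D * (real (Suc m) powr (\<mu> / p) * real (Suc n) powr (- (\<nu> / p))
              * real (max (Suc m) (Suc n)) powr (- s)) * u n)"
        by (intro sum_mono mult_right_mono K_le) (simp add: u_def)
      also have "\<dots> = D * real (Suc m) powr (\<mu> / p)
          * (\<Sum>n<N. real (Suc n) powr \<alpha> * real (max (Suc m) (Suc n)) powr (- s))"
        unfolding sum_distrib_left u_def \<alpha>_def
        by (rule sum.cong) (simp_all only: diff_conv_add_uminus powr_add mult_ac)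
      also have "\<dots> \<le> D * real (Suc m) powr (\<mu> / p) * (A * real (Suc m) powr (\<alpha> + 1 - s))"
        using D(1) by (intro mult_left_mono A(2)) auto
      also have "\<dots> = D * A * real (Suc m) powr (\<mu> / p + (\<alpha> + 1 - s))"
        by (simp only: powr_add mult_ac)
      \<comment> \<open>Homogeneity of degree -1: the choice of \<open>s\<close> gives
        \<open>\<mu> / p - \<nu> / p - s = -1\<close>, so the weight reproduces itself.\<close>
      also have "\<mu> / p + (\<alpha> + 1 - s) = - (1 / p)"
        using assms(1) by (simp add: \<alpha>_def s_def field_simps)
      finally show "(\<Sum>n<N. K (Suc m) (Suc n) * u n) \<le> D * A * u m"
        by (simp only: u_def)
    next
      fix n M
      have "(\<Sum>m<M. K (Suc m) (Suc n) * u m powr (p - 1))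
          \<le> (\<Sum>m<M. D * (real (Suc m) powr (\<mu> / p) * real (Suc n) powr (- (\<nu> / p))
              * real (max (Suc m) (Suc n)) powr (- s)) * u m powr (p - 1))"
        by (intro sum_mono mult_right_mono K_le) simp
      also have "\<dots> = D * real (Suc n) powr (- (\<nu> / p))
          * (\<Sum>m<M. real (Suc m) powr \<beta> * real (max (Suc n) (Suc m)) powr (- s))"
        unfolding sum_distrib_left u_powr \<beta>_def
        by (rule sum.cong) (simp_all only: diff_conv_add_uminus powr_add mult_ac max.commute)
      also have "\<dots> \<le> D * real (Suc n) powr (- (\<nu> / p)) * (B * real (Suc n) powr (\<beta> + 1 - s))"
        using D(1) by (intro mult_left_mono B(2)) auto
      also have "\<dots> = D * B * real (Suc n) powr (- (\<nu> / p) + (\<beta> + 1 - s))"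
        by (simp only: powr_add mult_ac)
      also have "- (\<nu> / p) + (\<beta> + 1 - s) = - ((p - 1) / p)"
        using assms(1) by (simp add: \<beta>_def s_def field_simps)
      finally show "(\<Sum>m<M. K (Suc m) (Suc n) * u m powr (p - 1)) \<le> D * B * u n powr (p - 1)"
        by (simp only: u_powr)
    qed (use assms(1) A(1) B(1) D(1) M_nonneg in \<open>simp_all add: u_def K_def\<close>)
  qed

  \<comment> \<open>Necessity of the Carleson condition\<close>
  moreover have "carleson_measure s \<rho>" if bdd: "bounded_on_lp p (\<lambda>m n. complex_of_real (K m n))"
  proof -
    obtain C where C: "\<And>N L. \<lbrakk>N \<ge> 1; 0 \<le> L;
        \<And>m n. \<lbrakk>m \<in> {N..<2 * N}; n \<in> {N..<2 * N}\<rbrakk> \<Longrightarrow> L \<le> K m n\<rbrakk> \<Longrightarrow> real N * L \<le> C"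
      using bounded_on_lp_block_bound[OF _ bdd] assms(1) by (metis less_imp_le)
    define c where "c = 2 powr (- \<bar>\<mu> / p\<bar>) * 2 powr (- \<bar>- (\<nu> / p)\<bar>)"
    have "c > 0"
      by (simp add: c_def)
    have "M (2 * N) \<le> C / c * real N powr (- s)" if N: "N \<ge> 1" for N
    proof -
      \<comment> \<open>A lower bound for \<open>K\<close> on the block: each power loses its dyadic
        constant collected in \<open>c\<close>, and \<open>max m n - 1 \<le> 2 * N\<close> bounds
        the moment below by \<open>M (2 * N)\<close>.\<close>
      define L where "L = c * real N powr (\<mu> / p + - (\<nu> / p)) * M (2 * N)"
      have "real N * L \<le> C"
      proof (rule C[OF N])
        show "0 \<le> L"
          using \<open>c > 0\<close> M_nonneg by (simp add: L_def)
        fix m n assume mn: "m \<in> {N..<2 * N}" "n \<in> {N..<2 * N}"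
        have "L = (2 powr (- \<bar>\<mu> / p\<bar>) * real N powr (\<mu> / p))
            * (2 powr (- \<bar>- (\<nu> / p)\<bar>) * real N powr (- (\<nu> / p))) * M (2 * N)"
          by (simp only: L_def c_def powr_add mult_ac)
        also have "\<dots> \<le> real m powr (\<mu> / p) * real n powr (- (\<nu> / p)) * M (max m n - 1)"
          using mn N by (intro mult_mono powr_ge_on_dyadic_block M_antimono M_nonneg) auto
        finally show "L \<le> K m n"
          by (simp only: K_def)
      qed
      also have "real N * L = c * (real N powr (1 + (\<mu> / p + - (\<nu> / p))) * M (2 * N))"
        using N unfolding L_def powr_add by simp
      also have "1 + (\<mu> / p + - (\<nu> / p)) = s"
        by (simp add: s_def diff_divide_distrib)
      finally show ?thesis
        using \<open>c > 0\<close> N by (simp add: powr_minus field_simps)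
    qed
    then show ?thesis
      unfolding M_def by (rule carleson_of_moment_le[OF \<rho> \<open>s > 0\<close>])
  qed
  ultimately show ?thesis
    unfolding kernel \<rho>_def[symmetric] s_def[symmetric] by blast
qed

end
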